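(* Let $k \ge 2$ and $n \ge k+1$ be integers, and let $\mathcal{A}\subset 2^{[n]}$ be a collection of sets that is both induced $Y_k$-free and induced $Y_k'$-free and such that $\varnothing,[n]\notin\mathcal{A}$. Then $$\sum_{A\in\mathcal{A}}\frac{1}{\binom{n}{|A|}}\le k.$$
   Context: Let $[n]=\{1,2,\dots,n\}$ and let $2^{[n]}$ denote the power set of $[n]$. A poset $P$ is an induced subposet of a poset $Q$ if there exists an injection $\phi:P\to Q$ such that $x<y$ in $P$ if and only if $\phi(x)<\phi(y)$ in $Q$. A family $\mathcal{A}\subset 2^{[n]}$ is regarded as a poset under set containment, and $\mathcal{A}$ is called induced $P$-free if $P$ is not an induced subposet of $\mathcal{A}$. $Y_k$ denotes the poset on $k+2$ elements $x_1,x_2,\dots,x_k,y,z$ whose relations are generated by $x_1<x_2<\dots<x_k$, $x_k<y$, $x_k<z$ (so $y$ and $z$ are incomparable). $Y_k'$ denotes the same poset with all relations reversed. *)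

theory Defs
  imports Complex_Main
begin

text \<open>A poset is given by a carrier set together with its strict order, as a relation.\<close>

definition induced_subposet ::
  "'a set \<Rightarrow> 'a rel \<Rightarrow> 'b set \<Rightarrow> 'b rel \<Rightarrow> bool" where
  "induced_subposet P r Q s \<longleftrightarrow>
     (\<exists>\<phi>. inj_on \<phi> P \<and> \<phi> ` P \<subseteq> Q \<and>
        (\<forall>x\<in>P. \<forall>y\<in>P. (x, y) \<in> r \<longleftrightarrow> (\<phi> x, \<phi> y) \<in> s))"

definition containment :: "'a set set \<Rightarrow> 'a set rel" where
  "containment \<A> = {(A, B). A \<in> \<A> \<and> B \<in> \<A> \<and> A \<subset> B}"

definition induced_free :: "'p set \<Rightarrow> 'p rel \<Rightarrow> 'a set set \<Rightarrow> bool" where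
  "induced_free P r \<A> \<longleftrightarrow> \<not> induced_subposet P r \<A> (containment \<A>)"

datatype Y_elem = x_elem nat | y_elem | z_elem

definition Y_carrier :: "nat \<Rightarrow> Y_elem set" where
  "Y_carrier k = x_elem ` {1..k} \<union> {y_elem, z_elem}"

definition Y_generators :: "nat \<Rightarrow> Y_elem rel" where
  "Y_generators k =
     {(x_elem i, x_elem (Suc i)) | i. 1 \<le> i \<and> i < k} \<union>
     {(x_elem k, y_elem), (x_elem k, z_elem)}"

definition Y_less :: "nat \<Rightarrow> Y_elem rel" where
  "Y_less k = (Y_generators k)\<^sup>+"

definition induced_Y_free :: "nat \<Rightarrow> 'a set set \<Rightarrow> bool" where
  "induced_Y_free k \<A> \<longleftrightarrow> induced_free (Y_carrier k) (Y_less k) \<A>"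

definition induced_Y'_free :: "nat \<Rightarrow> 'a set set \<Rightarrow> bool" where
  "induced_Y'_free k \<A> \<longleftrightarrow> induced_free (Y_carrier k) ((Y_less k)\<inverse>) \<A>"

end

theory Submission
  imports Defs "HOL-Combinatorics.Multiset_Permutations"
begin

text \<open>
  Count pairs of a permutation of \<open>[n]\<close>, read as the maximal chain of its prefix sets, and a
  member of \<open>\<A>\<close> on that chain. A set \<open>A\<close> is a prefix set of
  \<open>|A|! (n - |A|)!\<close> permutations, so the inequality says that a maximal chain carries at
  most \<open>k\<close> members on average.

  For a member \<open>A\<close> let \<open>d A\<close> be the size of the longest chain in \<open>\<A>\<close> with top
  \<open>A\<close>, and \<open>u A\<close> that of the longest one with bottom \<open>A\<close>. If \<open>d A \<ge> k\<close>, then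
  two incomparable members above \<open>A\<close> would complete a \<open>Y\<^sub>k\<close>, so the members above \<open>A\<close>
  form a chain; dually the members below \<open>A\<close> form a chain if \<open>u A \<ge> k\<close>.

  The second ingredient is a flip. Suppose that the members below \<open>b\<close> form a chain, and
  replace the part of a maximal chain below \<open>b\<close> by its complements in \<open>b\<close>, that is,
  reverse the corresponding prefix of the permutation. The old and the new chain cannot both
  carry a member below \<open>b\<close>: if \<open>A\<close> is on the old and \<open>B\<close> on the new one, then
  \<open>A\<close> is comparable both to \<open>B\<close> and to \<open>b - B\<close>, which is impossible for nonempty
  proper subsets of \<open>b\<close>. This is where \<open>{} \<notin> \<A>\<close> enters, and
  \<open>[n] \<notin> \<A>\<close> enters dually. So at most half of the maximal chains through \<open>b\<close>
  carry a member below \<open>b\<close> (\<open>flippable_below\<close>, \<open>flippable_above\<close>).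

  Maximal chains fall into three classes, according to the members on them.

  \<^item> If all of these have \<open>d < k\<close>, or all have \<open>u < k\<close>, then there are fewer than
    \<open>k\<close> of them, because \<open>d\<close> and \<open>u\<close> are strictly monotone.

  \<^item> If some have \<open>u \<ge> k\<close> and some have \<open>d \<ge> k\<close>, but none has both, let \<open>b\<close> be
    the largest one with \<open>u \<ge> k\<close> and \<open>t\<close> the smallest one with \<open>d \<ge> k\<close>; then
    \<open>b \<subset> t\<close>. With \<open>q\<close> members from \<open>b\<close> to \<open>t\<close>, monotonicity of \<open>d\<close> and \<open>u\<close>
    gives \<open>q + (d b - 1) \<le> k\<close> and \<open>q + (u t - 1) \<le> k\<close>. At most \<open>d b - 1\<close>
    members of the chain are below \<open>b\<close>, and after averaging over flips at most half as
    many; similarly above \<open>t\<close>. The average of these two bounds is what is needed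
    (\<open>sum_split_chains\<close>).

  \<^item> Otherwise some member on the chain is a core member: \<open>u \<ge> k\<close> and
    \<open>d \<ge> k\<close>. Let \<open>x \<ge> 1\<close> be the number of these, and let \<open>\<epsilon>\<close>
    and \<open>\<delta>\<close> in \<open>{0, 1}\<close> tell whether the chain has members below, respectively
    above, all of them. All core members but possibly the lowest one have a member of the chain
    below them, so \<open>x - 1 + \<epsilon>\<close> of them do, and by flipping this is at most
    \<open>x / 2\<close> on average. With the dual bound, \<open>x + \<epsilon> + \<delta> \<le> 2\<close> on
    average. As at most \<open>k - 1\<close> members lie on either side of the core, this implies the
    bound \<open>k\<close> (\<open>sum_core_chains\<close>).

  The counting uses the sets only through comparability and flips. It is carried out in a locale
  that is symmetric under reversal of the order, so that every estimate comes with its dual.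
\<close>

section \<open>Chains ending at a member\<close>

inductive ends_chain :: "('a \<Rightarrow> 'a \<Rightarrow> bool) \<Rightarrow> 'a set \<Rightarrow> nat \<Rightarrow> 'a \<Rightarrow> bool"
  for R F where
  single: "A \<in> F \<Longrightarrow> ends_chain R F 1 A"
| extend: "ends_chain R F j A \<Longrightarrow> R A B \<Longrightarrow> B \<in> F \<Longrightarrow> ends_chain R F (Suc j) B"

definition height :: "('a \<Rightarrow> 'a \<Rightarrow> bool) \<Rightarrow> 'a set \<Rightarrow> 'a \<Rightarrow> nat" where
  "height R F A = Max {j. ends_chain R F j A}"

lemma ends_chain_member: "ends_chain R F j A \<Longrightarrow> A \<in> F"
  by (induction rule: ends_chain.induct) auto

lemma ends_chain_pos: "ends_chain R F j A \<Longrightarrow> j \<ge> 1"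
  by (induction rule: ends_chain.induct) auto

lemma ends_chain_drop_one:
  "ends_chain R F j A \<Longrightarrow> j > 1 \<Longrightarrow> ends_chain R F (j - 1) A"
proof (induction rule: ends_chain.induct)
  case (single A)
  then show ?case by simp
next
  case (extend j A B)
  show ?case
  proof (cases "j = 1")
    case True
    then show ?thesis using extend ends_chain.single by fastforce
  next
    case False
    then have "j > 1" using ends_chain_pos[OF extend(1)] by simp
    with extend have "ends_chain R F (Suc (j - 1)) B"
      by (blast intro: ends_chain.extend)
    then show ?thesis using \<open>j > 1\<close> by simp
  qed
qed

lemma ends_chain_shorter:
  assumes "ends_chain R F j A" "1 \<le> i" "i \<le> j"
  shows "ends_chain R F i A"
proof -
  have "m < j \<Longrightarrow> ends_chain R F (j - m) A" for m
  proof (induction m)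
    case 0
    then show ?case using assms by simp
  next
    case (Suc m)
    then show ?case using ends_chain_drop_one[of R F "j - m" A] by simp
  qed
  from this[of "j - i"] show ?thesis using assms by simp
qed

lemma ends_chain_enumeration:
  "ends_chain R F j A \<Longrightarrow>
    \<exists>c. (\<forall>i\<in>{1..j}. c i \<in> F) \<and> (\<forall>i. 1 \<le> i \<and> i < j \<longrightarrow> R (c i) (c (Suc i))) \<and> c j = A"
proof (induction rule: ends_chain.induct)
  case (single A)
  then show ?case by (intro exI[of _ "\<lambda>_. A"]) simp
next
  case (extend j A B)
  then obtain c where c: "\<forall>i\<in>{1..j}. c i \<in> F"
    "\<forall>i. 1 \<le> i \<and> i < j \<longrightarrow> R (c i) (c (Suc i))" "c j = A" by blast
  show ?case
    by (rule exI[of _ "c(Suc j := B)"]) (use c extend in \<open>auto simp: less_Suc_eq\<close>)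
qed

text \<open>The order is a predicate, not the type class order, so that it can be instantiated both with
  \<open>\<subset>\<close> and with its converse.\<close>

locale finite_strict_order =
  fixes R :: "'a \<Rightarrow> 'a \<Rightarrow> bool" and F :: "'a set"
  assumes irrefl: "\<not> R a a"
    and trans: "R a b \<Longrightarrow> R b c \<Longrightarrow> R a c"
    and finite_F: "finite F"
begin

lemma ends_chain_bounded: "ends_chain R F j A \<Longrightarrow> j \<le> Suc (card {B \<in> F. R B A})"
proof (induction rule: ends_chain.induct)
  case (single A)
  then show ?case by simp
next
  case (extend j A B)
  have "A \<in> F" using extend ends_chain_member by fast
  have "{C \<in> F. R C A} \<subset> {C \<in> F. R C B}"
    using trans extend(2) irrefl \<open>A \<in> F\<close> by blast
  then have "card {C \<in> F. R C A} < card {C \<in> F. R C B}"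
    by (intro psubset_card_mono) (use finite_F in auto)
  then show ?case using extend by simp
qed

lemma finite_chain_lengths: "finite {j. ends_chain R F j A}"
  by (rule finite_subset[of _ "{..Suc (card {B \<in> F. R B A})}"]) (use ends_chain_bounded in auto)

lemma ends_chain_height:
  assumes "A \<in> F"
  shows "ends_chain R F (height R F A) A"
proof -
  have "1 \<in> {j. ends_chain R F j A}" using ends_chain.single[OF assms] by simp
  then have "Max {j. ends_chain R F j A} \<in> {j. ends_chain R F j A}"
    by (intro Max_in finite_chain_lengths) blast
  then show ?thesis unfolding height_def by simp
qed

lemma ends_chain_le_height: "ends_chain R F j A \<Longrightarrow> j \<le> height R F A"
  unfolding height_def using finite_chain_lengths by simp

lemma height_pos: "A \<in> F \<Longrightarrow> 1 \<le> height R F A"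
  using ends_chain_height ends_chain_pos by fast

lemma height_strict_mono: "A \<in> F \<Longrightarrow> B \<in> F \<Longrightarrow> R A B \<Longrightarrow> height R F A < height R F B"
  using ends_chain_le_height[OF ends_chain.extend[OF ends_chain_height]] by (simp add: Suc_le_eq)

text \<open>A chain is bounded by the number of heights available to it, as the height is strictly
  monotone and hence injective on it. All bounds on the number of members in a part of a maximal
  chain come from here.\<close>

lemma card_chain_le_heights:
  assumes "Z \<subseteq> F" "\<And>A B. A \<in> Z \<Longrightarrow> B \<in> Z \<Longrightarrow> A = B \<or> R A B \<or> R B A"
    and "\<And>A. A \<in> Z \<Longrightarrow> lo \<le> height R F A \<and> height R F A < hi"
  shows "card Z \<le> hi - lo"
proof -
  have "inj_on (height R F) Z"
    by (rule inj_onI) (metis assms(1,2) height_strict_mono nat_less_le subsetD)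
  moreover have "height R F ` Z \<subseteq> {lo..<hi}" using assms(3) by auto
  ultimately show ?thesis using card_inj_on_le[of "height R F" Z "{lo..<hi}"] by simp
qed

end

section \<open>Averaging over flips\<close>

text \<open>The elements of \<open>P\<close> stand for maximal chains of the ambient poset, and
  \<open>H c\<close> for the members of \<open>F\<close> that lie on \<open>c\<close>. A flip at \<open>b\<close> is an
  involution of the maximal chains through \<open>b\<close> that changes a chain only below \<open>b\<close>, in
  such a way that a chain and its image never both meet \<open>F\<close> below \<open>b\<close>. So at least
  half of the maximal chains through \<open>b\<close> avoid \<open>F\<close> below \<open>b\<close>.\<close>

definition is_flip ::
  "('a \<Rightarrow> 'a \<Rightarrow> bool) \<Rightarrow> 'c set \<Rightarrow> ('c \<Rightarrow> 'a set) \<Rightarrow> 'a \<Rightarrow> ('c \<Rightarrow> 'c) \<Rightarrow> bool" where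
  "is_flip R P H b f \<longleftrightarrow> (\<forall>c\<in>P. b \<in> H c \<longrightarrow>
     f c \<in> P \<and> f (f c) = c \<and> (\<forall>A. A = b \<or> R b A \<longrightarrow> (A \<in> H (f c) \<longleftrightarrow> A \<in> H c)) \<and>
     ((\<exists>A\<in>H c. R A b) \<longrightarrow> \<not> (\<exists>A\<in>H (f c). R A b)))"

definition flippable ::
  "('a \<Rightarrow> 'a \<Rightarrow> bool) \<Rightarrow> 'c set \<Rightarrow> ('c \<Rightarrow> 'a set) \<Rightarrow> 'a \<Rightarrow> bool" where
  "flippable R P H b \<longleftrightarrow> (\<exists>f. is_flip R P H b f)"

lemma sum_involution_le:
  fixes g h :: "'c \<Rightarrow> nat"
  assumes "\<And>c. c \<in> S \<Longrightarrow> f c \<in> S" "\<And>c. c \<in> S \<Longrightarrow> f (f c) = c"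
    and "\<And>c. c \<in> S \<Longrightarrow> g c + g (f c) \<le> h c"
  shows "2 * sum g S \<le> sum h S"
proof -
  have "bij_betw f S S" by (rule bij_betw_byWitness[of _ f]) (use assms in auto)
  then have "(\<Sum>c\<in>S. g (f c)) = sum g S" by (rule sum.reindex_bij_betw)
  then have "2 * sum g S = (\<Sum>c\<in>S. g c + g (f c))" by (simp add: sum.distrib)
  also have "\<dots> \<le> sum h S" by (rule sum_mono) (rule assms(3))
  finally show ?thesis .
qed

text \<open>The assumptions are invariant under reversing \<open>R\<close>, which exchanges \<open>d\<close> and
  \<open>u\<close> below. A large \<open>u b\<close> permits flips below \<open>b\<close>, since it forces the members
  below \<open>b\<close> into a chain.\<close>

locale flip_system = finite_strict_order R F
  for R :: "'a \<Rightarrow> 'a \<Rightarrow> bool" and F :: "'a set" +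
  fixes P :: "'c set" and H :: "'c \<Rightarrow> 'a set" and k :: nat
  assumes finite_P: "finite P"
    and k_ge_2: "k \<ge> 2"
    and H_sub: "c \<in> P \<Longrightarrow> H c \<subseteq> F"
    and H_chain: "c \<in> P \<Longrightarrow> A \<in> H c \<Longrightarrow> B \<in> H c \<Longrightarrow> A = B \<or> R A B \<or> R B A"
    and flip_down: "b \<in> F \<Longrightarrow> k \<le> height (\<lambda>x y. R y x) F b \<Longrightarrow> flippable R P H b"
    and flip_up: "b \<in> F \<Longrightarrow> k \<le> height R F b \<Longrightarrow> flippable (\<lambda>x y. R y x) P H b"
begin

lemma dual: "flip_system (\<lambda>x y. R y x) F P H k"
  by unfold_locales
     (use irrefl trans finite_F finite_P k_ge_2 H_sub H_chain flip_down flip_up in blast)+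

abbreviation d where "d \<equiv> height R F"
abbreviation u where "u \<equiv> height (\<lambda>x y. R y x) F"

lemma H_member: "c \<in> P \<Longrightarrow> A \<in> H c \<Longrightarrow> A \<in> F"
  using H_sub by blast

lemma finite_H: "c \<in> P \<Longrightarrow> finite (H c)"
  using H_sub finite_F finite_subset by blast

lemma u_strict_anti: "A \<in> F \<Longrightarrow> B \<in> F \<Longrightarrow> R A B \<Longrightarrow> u B < u A"
proof -
  interpret dual: flip_system "\<lambda>x y. R y x" F P H k by (rule dual)
  show "A \<in> F \<Longrightarrow> B \<in> F \<Longrightarrow> R A B \<Longrightarrow> u B < u A" by (rule dual.height_strict_mono)
qed

lemma u_pos: "A \<in> F \<Longrightarrow> 1 \<le> u A"
proof -
  interpret dual: flip_system "\<lambda>x y. R y x" F P H k by (rule dual)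
  show "A \<in> F \<Longrightarrow> 1 \<le> u A" by (rule dual.height_pos)
qed

lemma card_H_no_high:
  assumes "c \<in> P" "\<not> (\<exists>A\<in>H c. k \<le> d A)"
  shows "card (H c) \<le> k"
proof -
  have "card (H c) \<le> k - 1"
    by (rule card_chain_le_heights)
       (use assms H_sub H_chain height_pos[OF H_member] in \<open>auto simp: not_le\<close>)
  then show ?thesis by simp
qed

text \<open>On a chain of this class every member with \<open>k \<le> u\<close> lies below every member with
  \<open>k \<le> d\<close>: in the opposite order, or if they coincided, monotonicity would give one
  member both properties.\<close>

definition split_chains :: "'c set" where
  "split_chains = {c \<in> P. (\<exists>A\<in>H c. k \<le> u A) \<and> (\<exists>A\<in>H c. k \<le> d A) \<and>
     \<not> (\<exists>A\<in>H c. k \<le> u A \<and> k \<le> d A)}"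

definition is_top :: "'c \<Rightarrow> 'a \<Rightarrow> bool" where
  "is_top c b \<longleftrightarrow> b \<in> H c \<and> k \<le> u b \<and> (\<forall>A\<in>H c. k \<le> u A \<longrightarrow> A = b \<or> R A b)"

definition top_of :: "'c \<Rightarrow> 'a" where
  "top_of c = (SOME b. is_top c b)"

lemma is_top_unique: "is_top c a \<Longrightarrow> is_top c b \<Longrightarrow> a = b"
  unfolding is_top_def using irrefl trans by blast

lemma ex_is_top:
  assumes "c \<in> P" "\<exists>A\<in>H c. k \<le> u A"
  shows "\<exists>b. is_top c b"
proof -
  let ?Z = "{A \<in> H c. k \<le> u A}"
  have fin: "finite ?Z" using finite_H[OF assms(1)] by simp
  define b where "b = arg_min_on u ?Z"
  have b: "b \<in> ?Z" unfolding b_def by (rule arg_min_if_finite(1)[OF fin]) (use assms in blast)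
  have min: "u b \<le> u A" if "A \<in> ?Z" for A
    unfolding b_def by (rule arg_min_least[OF fin _ that]) (use assms in blast)
  have "A = b \<or> R A b" if A: "A \<in> ?Z" for A
  proof -
    have "\<not> R b A"
      using u_strict_anti[of b A] min[OF A] H_sub[OF assms(1)] A b by fastforce
    then show ?thesis using H_chain[OF assms(1), of A b] A b by blast
  qed
  then show ?thesis using b unfolding is_top_def by blast
qed

lemma is_top_top_of: "c \<in> split_chains \<Longrightarrow> is_top c (top_of c)"
  unfolding top_of_def split_chains_def using someI_ex[OF ex_is_top] by blast

lemma top_of_eq: "is_top c b \<Longrightarrow> top_of c = b"
  unfolding top_of_def using is_top_unique by blast

definition below_top :: "'c \<Rightarrow> 'a set" where
  "below_top c = {A \<in> H c. R A (top_of c)}"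

lemma card_below_top:
  assumes "c \<in> split_chains"
  shows "card (below_top c) \<le> d (top_of c) - 1"
proof (rule card_chain_le_heights)
  have c: "c \<in> P" using assms by (simp add: split_chains_def)
  note t = is_top_top_of[OF assms]
  show "below_top c \<subseteq> F" using H_sub[OF c] unfolding below_top_def by blast
  show "A = B \<or> R A B \<or> R B A" if "A \<in> below_top c" "B \<in> below_top c" for A B
    using that H_chain[OF c] unfolding below_top_def by blast
  show "1 \<le> d A \<and> d A < d (top_of c)" if "A \<in> below_top c" for A
    using that t H_sub[OF c] height_pos height_strict_mono
    unfolding below_top_def is_top_def by blast
qed

text \<open>Flipping each chain at its own top \<open>b\<close> is an involution of the class, because the flip
  preserves the choice of \<open>b\<close>. Of a chain and its image, one carries nothing below
  \<open>b\<close> and the other at most \<open>d b - 1\<close> members.\<close>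

lemma sum_below_top:
  "2 * (\<Sum>c\<in>split_chains. card (below_top c)) \<le> (\<Sum>c\<in>split_chains. d (top_of c) - 1)"
proof -
  define fl where "fl b = (SOME f. is_flip R P H b f)" for b
  have fl: "is_flip R P H b (fl b)" if "b \<in> F" "k \<le> u b" for b
    unfolding fl_def using flip_down[OF that] unfolding flippable_def by (rule someI_ex)
  define f where "f c = fl (top_of c) c" for c
  have main: "f c \<in> split_chains \<and> top_of (f c) = top_of c \<and> f (f c) = c \<and>
      (below_top c = {} \<or> below_top (f c) = {})" if c: "c \<in> split_chains" for c
  proof -
    have cP: "c \<in> P" using c by (simp add: split_chains_def)
    define b where "b = top_of c"
    have top: "is_top c b" using is_top_top_of[OF c] by (simp add: b_def)
    have b: "b \<in> H c" "b \<in> F" "k \<le> u b"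
      using top H_sub[OF cP] unfolding is_top_def by auto
    have q: "f c \<in> P" "fl b (fl b c) = c"
      "\<And>A. A = b \<or> R b A \<Longrightarrow> A \<in> H (f c) \<longleftrightarrow> A \<in> H c"
      "(\<exists>A\<in>H c. R A b) \<longrightarrow> \<not> (\<exists>A\<in>H (f c). R A b)"
      using fl[OF b(2,3)] cP b(1) unfolding is_flip_def f_def b_def[symmetric] by blast+
    have bf: "b \<in> H (f c)" using q(3) b(1) by blast
    have comp: "A = b \<or> R b A \<or> R A b" if "A \<in> H (f c)" for A
      using H_chain[OF q(1) that bf] by blast
    have tf: "is_top (f c) b"
      unfolding is_top_def
    proof (intro conjI ballI impI)
      fix A assume A: "A \<in> H (f c)" "k \<le> u A"
      show "A = b \<or> R A b"
        using comp[OF A(1)] A q(3)[of A] top irrefl trans unfolding is_top_def by blast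
    qed (use bf b in auto)
    have tfe: "top_of (f c) = b" by (rule top_of_eq[OF tf])
    have low: "d b < k" using c b unfolding split_chains_def by (auto simp: not_le)
    have dlow: "d A < k" if "A \<in> H (f c)" "A = b \<or> R A b" for A
      using that low height_strict_mono[of A b] H_sub[OF q(1)] b(2) by fastforce
    obtain T where T: "T \<in> H c" "k \<le> d T" using c unfolding split_chains_def by blast
    have "R b T"
      using H_chain[OF cP T(1) b(1)] T low height_strict_mono[of T b] H_sub[OF cP] b(2)
      by fastforce
    then have Tf: "T \<in> H (f c)" using q(3) T by blast
    \<comment> \<open>A new core member could only appear below \<open>b\<close>, where \<open>d\<close> is too small.\<close>
    have nocore: "\<not> (k \<le> u A \<and> k \<le> d A)" if A: "A \<in> H (f c)" for A
      using comp[OF A] dlow[OF A] q(3)[of A] A c unfolding split_chains_def by fastforce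
    have "f c \<in> split_chains"
      unfolding split_chains_def using q(1) bf b(3) Tf T(2) nocore by blast
    moreover have "f (f c) = c"
      using q(2) tfe unfolding f_def b_def by simp
    moreover have "below_top c = {} \<or> below_top (f c) = {}"
      unfolding below_top_def tfe b_def[symmetric] using q(4) by blast
    ultimately show ?thesis using tfe b_def by simp
  qed
  show ?thesis
  proof (rule sum_involution_le[of _ f])
    fix c assume c: "c \<in> split_chains"
    show "f c \<in> split_chains" "f (f c) = c" using main[OF c] by blast+
    show "card (below_top c) + card (below_top (f c)) \<le> d (top_of c) - 1"
      using main[OF c] card_below_top[OF c] card_below_top[of "f c"] by auto
  qed
qed

text \<open>The heights \<open>d\<close> of the members from \<open>b = top_of c\<close> up to, but excluding, \<open>t\<close> lie
  in \<open>{d b..<k}\<close>, because \<open>t\<close> is the lowest member with \<open>k \<le> d\<close>.\<close>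

lemma card_H_split_low:
  assumes c: "c \<in> split_chains" and t: "t \<in> H c" "k \<le> d t" "\<forall>A\<in>H c. k \<le> d A \<longrightarrow> A = t \<or> R t A"
  shows "card (H c) + d (top_of c) \<le> card (below_top c) + card {A \<in> H c. R t A} + 1 + k"
proof -
  have cP: "c \<in> P" using c by (simp add: split_chains_def)
  define b where "b = top_of c"
  have top: "is_top c b" using is_top_top_of[OF c] by (simp add: b_def)
  have b: "b \<in> H c" "b \<in> F" "k \<le> u b"
    using top H_sub[OF cP] unfolding is_top_def by auto
  have low: "d b < k" using c b unfolding split_chains_def by (auto simp: not_le)
  define M where "M = {A \<in> H c. (A = b \<or> R b A) \<and> R A t}"
  have "card M \<le> k - d b"
  proof (rule card_chain_le_heights)
    show "M \<subseteq> F" using H_sub[OF cP] unfolding M_def by blast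
    show "A = B \<or> R A B \<or> R B A" if "A \<in> M" "B \<in> M" for A B
      using that H_chain[OF cP] unfolding M_def by blast
    show "d b \<le> d A \<and> d A < k" if A: "A \<in> M" for A
    proof
      show "d b \<le> d A"
        using A height_strict_mono[of b A] H_sub[OF cP] b(2) unfolding M_def by fastforce
      show "d A < k"
      proof (rule ccontr)
        assume "\<not> d A < k"
        then have "A = t \<or> R t A" using t(3) A unfolding M_def by auto
        then show False using A irrefl trans unfolding M_def by blast
      qed
    qed
  qed
  moreover have "H c \<subseteq> below_top c \<union> M \<union> {t} \<union> {A \<in> H c. R t A}"
    using H_chain[OF cP _ b(1)] H_chain[OF cP _ t(1)]
    unfolding M_def below_top_def b_def[symmetric] by blast
  then have "card (H c) \<le> card (below_top c \<union> M \<union> {t} \<union> {A \<in> H c. R t A})"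
    by (rule card_mono[rotated]) (use finite_H[OF cP] in \<open>auto simp: M_def below_top_def\<close>)
  moreover have "\<dots> \<le> card (below_top c) + card M + 1 + card {A \<in> H c. R t A}"
    by (rule order_trans[OF card_Un_le] add_mono order_refl | simp)+
  ultimately show ?thesis using low unfolding b_def[symmetric] by linarith
qed

text \<open>Adding \<open>card_H_split_low\<close> to its dual counts the members below \<open>b\<close> and above
  \<open>t\<close> twice each. By \<open>sum_below_top\<close> their doubled totals are paid for by the terms
  \<open>d b - 1\<close> and \<open>u t - 1\<close>, which leaves \<open>2 k\<close> per chain.\<close>

lemma sum_split_chains: "(\<Sum>c\<in>split_chains. card (H c)) \<le> k * card split_chains"
proof -
  interpret dual: flip_system "\<lambda>x y. R y x" F P H k by (rule dual)
  have sd: "dual.split_chains = split_chains"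
    unfolding dual.split_chains_def split_chains_def by blast
  let ?S = split_chains
  have pt: "2 * card (H c) + (d (top_of c) - 1) + (u (dual.top_of c) - 1)
      \<le> 2 * card (below_top c) + 2 * card (dual.below_top c) + 2 * k" if c: "c \<in> ?S" for c
  proof -
    have cP: "c \<in> P" using c by (simp add: split_chains_def)
    note t = is_top_top_of[OF c] and t' = dual.is_top_top_of[unfolded sd, OF c]
    have "card (H c) + d (top_of c) \<le> card (below_top c) + card (dual.below_top c) + 1 + k"
      using card_H_split_low[OF c, of "dual.top_of c"] t'
      unfolding dual.is_top_def dual.below_top_def by blast
    moreover have "card (H c) + u (dual.top_of c)
        \<le> card (dual.below_top c) + card (below_top c) + 1 + k"
      using dual.card_H_split_low[unfolded sd, OF c, of "top_of c"] t
      unfolding is_top_def below_top_def by blast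
    moreover have "1 \<le> d (top_of c)" "1 \<le> u (dual.top_of c)"
      using t t' H_sub[OF cP] height_pos u_pos unfolding is_top_def dual.is_top_def by blast+
    ultimately show ?thesis by linarith
  qed
  have "(\<Sum>c\<in>?S. 2 * card (H c) + (d (top_of c) - 1) + (u (dual.top_of c) - 1))
      \<le> (\<Sum>c\<in>?S. 2 * card (below_top c) + 2 * card (dual.below_top c) + 2 * k)"
    by (rule sum_mono) (rule pt)
  then have "2 * (\<Sum>c\<in>?S. card (H c)) + (\<Sum>c\<in>?S. d (top_of c) - 1) + (\<Sum>c\<in>?S. u (dual.top_of c) - 1)
      \<le> 2 * (\<Sum>c\<in>?S. card (below_top c)) + 2 * (\<Sum>c\<in>?S. card (dual.below_top c)) + 2 * (k * card ?S)"
    by (simp add: sum.distrib sum_distrib_left mult_ac)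
  then show ?thesis using sum_below_top dual.sum_below_top[unfolded sd] by linarith
qed

definition core :: "'c \<Rightarrow> 'a set" where
  "core c = {A \<in> H c. k \<le> u A \<and> k \<le> d A}"

definition core_above :: "'c \<Rightarrow> 'a set" where
  "core_above c = {A \<in> core c. \<exists>B\<in>H c. R B A}"

text \<open>For a fixed core member \<open>A\<close>, the flip at \<open>A\<close> acts on the chains through \<open>A\<close>
  and sends those with a member below \<open>A\<close> to chains without one.\<close>

lemma sum_core_above:
  "2 * (\<Sum>c\<in>P. card (core_above c)) \<le> (\<Sum>c\<in>P. card (core c))"
proof -
  define Q where "Q = {A \<in> F. k \<le> u A \<and> k \<le> d A}"
  have finQ: "finite Q" using finite_F unfolding Q_def by simp
  have each: "2 * card {c \<in> P. A \<in> core_above c} \<le> card {c \<in> P. A \<in> core c}" if A: "A \<in> Q" for A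
  proof -
    obtain f where f: "is_flip R P H A f"
      using flip_down[of A] A unfolding Q_def flippable_def by blast
    let ?S = "{c \<in> P. A \<in> core c}"
    have "2 * (\<Sum>c\<in>?S. of_bool (A \<in> core_above c)) \<le> (\<Sum>c\<in>?S. (1::nat))"
    proof (rule sum_involution_le[of _ f])
      fix c assume c: "c \<in> ?S"
      show "f c \<in> ?S" "f (f c) = c" using c f unfolding core_def is_flip_def by blast+
      show "of_bool (A \<in> core_above c) + of_bool (A \<in> core_above (f c)) \<le> (1::nat)"
        using c f unfolding core_above_def core_def is_flip_def by auto
    qed
    moreover have "(\<Sum>c\<in>?S. of_bool (A \<in> core_above c)) = card {c \<in> P. A \<in> core_above c}"
      using finite_P by (simp add: Int_def core_above_def conj_ac cong: conj_cong)
    ultimately show ?thesis by simp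
  qed
  have swap: "(\<Sum>c\<in>P. card (K c)) = (\<Sum>A\<in>Q. card {c \<in> P. A \<in> K c})"
    if "\<And>c. c \<in> P \<Longrightarrow> K c \<subseteq> Q" for K
  proof -
    have "(\<Sum>c\<in>P. card (K c)) = (\<Sum>c\<in>P. card {A \<in> Q. A \<in> K c})"
      by (rule sum.cong) (use that in \<open>auto intro!: arg_cong[of _ _ card]\<close>)
    also have "\<dots> = (\<Sum>A\<in>Q. card {c \<in> P. A \<in> K c})"
      using sum_multicount_gen[of P Q "\<lambda>c A. A \<in> K c" "\<lambda>A. card {c \<in> P. A \<in> K c}"]
        finite_P finQ by simp
    finally show ?thesis .
  qed
  have "core c \<subseteq> Q" "core_above c \<subseteq> Q" if "c \<in> P" for c
    using H_sub[OF that] unfolding core_above_def core_def Q_def by auto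
  then show ?thesis
    by (simp add: swap sum_distrib_left) (intro sum_mono each)
qed

text \<open>On a chain with core members, those with \<open>d < k\<close> lie below the entire core. If there are
  none, only the lowest core member can fail to be in \<open>core_above c\<close>; if there are some, no
  core member fails, and this pays for the at most \<open>k - 1\<close> low members.\<close>

lemma core_low_bound:
  assumes c: "c \<in> P" and ne: "core c \<noteq> {}"
  shows "card {A \<in> H c. d A < k} + (k - 1) * card (core c)
    \<le> (k - 1) * card (core_above c) + (k - 1)"
proof (cases "{A \<in> H c. d A < k} = {}")
  case True
  have fin: "finite (core c)" using finite_H[OF c] unfolding core_def by simp
  define m where "m = arg_min_on d (core c)"
  have m: "m \<in> core c" unfolding m_def by (rule arg_min_if_finite(1)[OF fin ne])
  have "core c \<subseteq> insert m (core_above c)"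
  proof
    fix A assume A: "A \<in> core c"
    have "d m \<le> d A" unfolding m_def by (rule arg_min_least[OF fin ne A])
    then have "\<not> R A m"
      using height_strict_mono[of A m] A m H_sub[OF c] unfolding core_def by fastforce
    then show "A \<in> insert m (core_above c)"
      using H_chain[OF c, of A m] A m unfolding core_above_def core_def by blast
  qed
  moreover have "finite (core_above c)" using fin unfolding core_above_def by simp
  ultimately have "card (core c) \<le> Suc (card (core_above c))"
    using card_mono[of "insert m (core_above c)" "core c"]
    by (simp add: card_insert_if split: if_splits)
  then have "(k - 1) * card (core c) \<le> (k - 1) * Suc (card (core_above c))" by (rule mult_le_mono2)
  then show ?thesis unfolding True by simp
next
  case False
  then obtain B where B: "B \<in> H c" "d B < k" by blast
  have "core_above c = core c"
  proof -
    have "R B A" if A: "A \<in> core c" for A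
      using H_chain[OF c B(1), of A] A B height_strict_mono[of A B] H_sub[OF c]
      unfolding core_def by fastforce
    then show ?thesis using B unfolding core_above_def by blast
  qed
  moreover have "card {A \<in> H c. d A < k} \<le> k - 1"
    by (rule card_chain_le_heights) (use H_sub[OF c] H_chain[OF c] height_pos[OF H_member[OF c]] in auto)
  ultimately show ?thesis by simp
qed

definition core_chains :: "'c set" where
  "core_chains = {c \<in> P. core c \<noteq> {}}"

text \<open>Write \<open>L\<close>, \<open>x\<close>, \<open>U\<close> for the numbers of members below, in and above the core,
  summed over the \<open>N\<close> chains of this class. The two core estimates and their duals give
  \<open>L + U + 2 (k - 1) x \<le> (k - 1) x + 2 (k - 1) N\<close>. Hence
  \<open>L + x + U \<le> 2 (k - 1) N - (k - 2) x \<le> k N\<close>, the last step because \<open>N \<le> x\<close>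
  and \<open>k \<ge> 2\<close>.\<close>

lemma sum_core_chains: "(\<Sum>c\<in>core_chains. card (H c)) \<le> k * card core_chains"
proof -
  interpret dual: flip_system "\<lambda>x y. R y x" F P H k by (rule dual)
  have cd: "dual.core = core" unfolding dual.core_def core_def by (auto simp: fun_eq_iff)
  let ?S = core_chains
  \<comment> \<open>Setting \<open>k = j + 2\<close> removes the truncated subtractions.\<close>
  obtain j where j: "k = Suc (Suc j)" using k_ge_2 by (metis add_2_eq_Suc le_Suc_ex)
  have S: "?S \<subseteq> P" unfolding core_chains_def by blast
  have rest: "(\<Sum>c\<in>P. card (K c)) = (\<Sum>c\<in>?S. card (K c))" if "\<And>c. K c \<subseteq> core c" for K
  proof (rule sum.mono_neutral_right[OF finite_P S], rule ballI)
    fix c assume "c \<in> P - ?S"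
    then have "core c = {}" unfolding core_chains_def by blast
    then show "card (K c) = 0" using that[of c] by simp
  qed
  have "core_above c \<subseteq> core c" "dual.core_above c \<subseteq> core c" for c
    unfolding core_above_def dual.core_above_def cd by auto
  then have half: "2 * (\<Sum>c\<in>?S. card (core_above c)) \<le> (\<Sum>c\<in>?S. card (core c))"
    "2 * (\<Sum>c\<in>?S. card (dual.core_above c)) \<le> (\<Sum>c\<in>?S. card (core c))"
    using sum_core_above dual.sum_core_above unfolding cd by (simp_all add: rest)
  have pt: "card (H c) + (2 * j + 1) * card (core c)
      \<le> (k - 1) * card (core_above c) + (k - 1) * card (dual.core_above c) + 2 * (k - 1)"
    if c: "c \<in> ?S" for c
  proof -
    have cP: "c \<in> P" and ne: "core c \<noteq> {}" using c unfolding core_chains_def by auto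
    obtain K where K: "K \<in> core c" using ne by blast
    have "k \<le> u A \<or> k \<le> d A" if A: "A \<in> H c" for A
      using H_chain[OF cP A, of K] K A height_strict_mono[of K A] u_strict_anti[of A K] H_sub[OF cP]
      unfolding core_def by fastforce
    then have "H c = {A \<in> H c. d A < k} \<union> {A \<in> H c. u A < k} \<union> core c"
      unfolding core_def by fastforce
    then have "card (H c) \<le> card {A \<in> H c. d A < k} + card {A \<in> H c. u A < k} + card (core c)"
      by (metis (no_types, lifting) card_Un_le add_le_mono1 order_trans)
    then show ?thesis
      using core_low_bound[OF cP ne] dual.core_low_bound[unfolded cd, OF cP ne]
      by (simp add: j algebra_simps)
  qed
  have "(\<Sum>c\<in>?S. card (H c) + (2 * j + 1) * card (core c))
      \<le> (\<Sum>c\<in>?S. (k - 1) * card (core_above c) + (k - 1) * card (dual.core_above c) + 2 * (k - 1))"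
    by (rule sum_mono) (rule pt)
  then have 1: "(\<Sum>c\<in>?S. card (H c)) + (2 * j + 1) * (\<Sum>c\<in>?S. card (core c))
      \<le> (k - 1) * (\<Sum>c\<in>?S. card (core_above c)) + (k - 1) * (\<Sum>c\<in>?S. card (dual.core_above c))
        + 2 * (k - 1) * card ?S"
    by (simp add: sum.distrib sum_distrib_left mult_ac)
  have 2: "(k - 1) * (\<Sum>c\<in>?S. card (core_above c)) + (k - 1) * (\<Sum>c\<in>?S. card (dual.core_above c))
      \<le> (k - 1) * (\<Sum>c\<in>?S. card (core c))"
  proof -
    have "(\<Sum>c\<in>?S. card (core_above c)) + (\<Sum>c\<in>?S. card (dual.core_above c)) \<le> (\<Sum>c\<in>?S. card (core c))"
      using half by linarith
    from mult_le_mono2[OF this, of "k - 1"] show ?thesis by (simp only: distrib_left)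
  qed
  have 3: "card ?S \<le> (\<Sum>c\<in>?S. card (core c))"
  proof -
    have "1 \<le> card (core c)" if "c \<in> ?S" for c
      using that finite_H[of c] unfolding core_chains_def core_def
      by (auto simp: Suc_le_eq card_gt_0_iff)
    then show ?thesis using sum_mono[of ?S "\<lambda>_. 1::nat" "\<lambda>c. card (core c)"] by simp
  qed
  have 4: "j * card ?S \<le> j * (\<Sum>c\<in>?S. card (core c))" using 3 by (rule mult_le_mono2)
  have "(\<Sum>c\<in>?S. card (H c)) + (2 * j + 1) * (\<Sum>c\<in>?S. card (core c))
      \<le> (j + 1) * (\<Sum>c\<in>?S. card (core c)) + 2 * (j + 1) * card ?S"
    using order_trans[OF 1 add_right_mono[OF 2]] by (simp add: j)
  then have "(\<Sum>c\<in>?S. card (H c)) + j * (\<Sum>c\<in>?S. card (core c)) \<le> 2 * (j + 1) * card ?S"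
    by (simp add: algebra_simps)
  moreover have "2 * (j + 1) * card ?S = k * card ?S + j * card ?S"
    unfolding j by (simp add: algebra_simps)
  ultimately show ?thesis using 4 by linarith
qed

theorem sum_card_H: "(\<Sum>c\<in>P. card (H c)) \<le> k * card P"
proof -
  interpret dual: flip_system "\<lambda>x y. R y x" F P H k by (rule dual)
  let ?N = "P - split_chains - core_chains"
  have sub: "split_chains \<subseteq> P" "core_chains \<subseteq> P"
    unfolding split_chains_def core_chains_def by auto
  have disj: "core_chains \<subseteq> P - split_chains"
    unfolding split_chains_def core_chains_def core_def by blast
  have parts: "sum g P = sum g split_chains + (sum g core_chains + sum g ?N)" for g :: "'c \<Rightarrow> nat"
    using sum.subset_diff[OF sub(1) finite_P, of g] sum.subset_diff[OF disj, of g] finite_P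
    by simp
  have "(\<Sum>c\<in>?N. card (H c)) \<le> (\<Sum>c\<in>?N. k)"
  proof (rule sum_mono)
    fix c assume c: "c \<in> ?N"
    then have "\<not> (\<exists>A\<in>H c. k \<le> d A) \<or> \<not> (\<exists>A\<in>H c. k \<le> u A)"
      unfolding split_chains_def core_chains_def core_def by blast
    then show "card (H c) \<le> k" using c card_H_no_high dual.card_H_no_high by blast
  qed
  then have N: "(\<Sum>c\<in>?N. card (H c)) \<le> k * card ?N" by (simp add: mult.commute)
  have "card P = card split_chains + (card core_chains + card ?N)"
    using parts[of "\<lambda>_. 1"] by simp
  then show ?thesis
    unfolding parts[of "\<lambda>c. card (H c)"]
    using N sum_split_chains sum_core_chains by (simp add: algebra_simps)
qed

end

section \<open>Permutations as maximal chains\<close>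

definition prefix_members :: "'a set set \<Rightarrow> 'a list \<Rightarrow> 'a set set" where
  "prefix_members F xs = {A \<in> F. set (take (card A) xs) = A}"

lemma prefix_members_comparable:
  assumes "A \<in> prefix_members F xs" "B \<in> prefix_members G xs"
  shows "A \<subseteq> B \<or> B \<subseteq> A"
  using assms set_take_subset_set_take[of "card A" "card B" xs]
    set_take_subset_set_take[of "card B" "card A" xs]
  unfolding prefix_members_def by (metis (mono_tags, lifting) mem_Collect_eq nat_le_linear)

lemma card_permutations_through:
  assumes "finite S" "A \<subseteq> S"
  shows "card {xs \<in> permutations_of_set S. set (take (card A) xs) = A}
    = fact (card A) * fact (card S - card A)"
proof -
  have finA: "finite A" using assms finite_subset by blast
  let ?T = "{xs \<in> permutations_of_set S. set (take (card A) xs) = A}"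
  let ?D = "permutations_of_set A \<times> permutations_of_set (S - A)"
  have "bij_betw (\<lambda>(xs, ys). xs @ ys) ?D ?T"
  proof (rule bij_betw_byWitness[of _ "\<lambda>xs. (take (card A) xs, drop (card A) xs)"])
    show "\<forall>p\<in>?D. (\<lambda>xs. (take (card A) xs, drop (card A) xs)) ((\<lambda>(xs, ys). xs @ ys) p) = p"
      by (auto simp: length_finite_permutations_of_set)
    show "\<forall>xs\<in>?T. (\<lambda>(xs, ys). xs @ ys) (take (card A) xs, drop (card A) xs) = xs" by simp
    show "(\<lambda>(xs, ys). xs @ ys) ` ?D \<subseteq> ?T"
      using assms by (auto simp: permutations_of_set_def distinct_card[symmetric])
    show "(\<lambda>xs. (take (card A) xs, drop (card A) xs)) ` ?T \<subseteq> ?D"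
    proof (rule image_subsetI)
      fix xs assume "xs \<in> ?T"
      then have xs: "xs \<in> permutations_of_set S" "set (take (card A) xs) = A" by auto
      have "distinct (take (card A) xs @ drop (card A) xs)" "set (take (card A) xs @ drop (card A) xs) = S"
        using xs by (auto simp: permutations_of_set_def)
      then have "set (drop (card A) xs) = S - A" unfolding distinct_append set_append using xs(2) by blast
      then show "(take (card A) xs, drop (card A) xs) \<in> ?D"
        using xs by (auto simp: permutations_of_set_def)
    qed
  qed
  then have "card ?T = card ?D" using bij_betw_same_card by fastforce
  also have "\<dots> = fact (card A) * fact (card S - card A)"
    using assms finA by (simp add: card_cartesian_product card_Diff_subset)
  finally show ?thesis .
qed

text \<open>After reversing the prefix with set \<open>B\<close>, its initial segments are the reversed final
  segments of the old prefix, that is, complements in \<open>B\<close> of old prefix sets.\<close>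

lemma prefix_flip:
  assumes "distinct xs" "set (take m xs) = B" "m = card B" "A \<subseteq> B"
  shows "set (take (card A) (rev (take m xs) @ drop m xs)) = A \<longleftrightarrow>
    set (take (card (B - A)) xs) = B - A"
proof -
  have finB: "finite B" using assms(2) by auto
  have len: "length (take m xs) = m"
    using assms distinct_card[of "take m xs"] by simp
  have A: "card A \<le> m" "card (B - A) = m - card A"
    using assms(3,4) finB card_mono[OF finB assms(4)]
      card_Diff_subset[OF finite_subset[OF assms(4) finB] assms(4)] by auto
  define ys where "ys = take m xs"
  have ys: "distinct ys" "set ys = B" "length ys = m" using assms len by (auto simp: ys_def)
  have "take (card A) (rev ys @ drop m xs) = rev (drop (m - card A) ys)"
    using A ys by (simp add: take_rev)
  moreover have "take (card (B - A)) xs = take (m - card A) ys"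
    using A by (simp add: ys_def)
  moreover have "set (take (m - card A) ys) \<union> set (drop (m - card A) ys) = B"
    "set (take (m - card A) ys) \<inter> set (drop (m - card A) ys) = {}"
    using ys by (metis append_take_drop_id set_append, metis append_take_drop_id distinct_append)
  ultimately show ?thesis using assms(4) unfolding ys_def[symmetric] by (simp, blast)
qed

text \<open>The counterpart for the part above \<open>B\<close>: complementation within the interval from
  \<open>B\<close> to \<open>S\<close> sends \<open>A\<close> to \<open>B \<union> (S - A)\<close>.\<close>

lemma suffix_flip:
  assumes "distinct xs" "set xs = S" "set (take m xs) = B" "m = card B" "B \<subseteq> A" "A \<subseteq> S"
  shows "set (take (card A) (take m xs @ rev (drop m xs))) = A \<longleftrightarrow>
    set (take (card (B \<union> (S - A))) xs) = B \<union> (S - A)"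
proof -
  have finS: "finite S" using assms(2) by auto
  then have fin: "finite B" "finite A" using assms finite_subset by blast+
  have len: "length (take m xs) = m"
    using assms distinct_card[of "take m xs"] by simp
  define ys zs where "ys = take m xs" and "zs = drop m xs"
  have xs: "xs = ys @ zs" by (simp add: ys_def zs_def)
  have ys: "set ys = B" "length ys = m" using assms len by (auto simp: ys_def)
  have zs: "distinct zs" "set zs = S - B"
    using assms(1,2) ys unfolding xs by auto
  have lz: "length zs = card S - m" using zs fin distinct_card[of zs] card_Diff_subset[of B S] assms by simp
  have cA: "m \<le> card A" "card A \<le> card S" using assms(4) card_mono[OF fin(2) assms(5)] card_mono[OF finS assms(6)] by auto
  have cC: "card (B \<union> (S - A)) = m + (card S - card A)"
    using assms fin finS by (subst card_Un_disjoint) (auto simp: card_Diff_subset)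
  define r where "r = card S - card A"
  have "take (card A) (ys @ rev zs) = ys @ rev (drop r zs)"
    using ys cA lz by (simp add: take_rev r_def)
  moreover have "take (card (B \<union> (S - A))) xs = ys @ take r zs"
    using ys unfolding cC xs r_def by simp
  moreover have "set (take r zs) \<union> set (drop r zs) = S - B"
    "set (take r zs) \<inter> set (drop r zs) = {}"
    using zs by (metis append_take_drop_id set_append, metis append_take_drop_id distinct_append)
  ultimately show ?thesis
    using assms(5,6) ys unfolding ys_def[symmetric] zs_def[symmetric] by (simp, blast)
qed

text \<open>If \<open>A\<close> is on a chain and \<open>B\<close> on its flip, then \<open>A\<close> and \<open>b - B\<close> are both on the
  former chain, hence comparable, and \<open>A\<close> and \<open>B\<close> are comparable by hypothesis. Since
  \<open>A\<close> and \<open>B\<close> are nonempty and proper in \<open>b\<close>, each of the four combinations is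
  contradictory.\<close>

lemma flippable_below:
  assumes F: "F \<subseteq> Pow S" "{} \<notin> F" and b: "b \<in> F"
    and chain: "\<And>A B. A \<in> F \<Longrightarrow> B \<in> F \<Longrightarrow> A \<subset> b \<Longrightarrow> B \<subset> b \<Longrightarrow> A \<subseteq> B \<or> B \<subseteq> A"
  shows "flippable (\<subset>) (permutations_of_set S) (prefix_members F) b"
  unfolding flippable_def is_flip_def
proof (intro exI[of _ "\<lambda>xs. rev (take (card b) xs) @ drop (card b) xs"] ballI impI)
  fix xs assume xs: "xs \<in> permutations_of_set S" and hit: "b \<in> prefix_members F xs"
  define m where "m = card b"
  define f where "f = rev (take m xs) @ drop m xs"
  have dist: "distinct xs" "set xs = S" using xs by (auto simp: permutations_of_set_def)
  have tb: "set (take m xs) = b" using hit by (simp add: prefix_members_def m_def)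
  have len: "length (take m xs) = m"
    using dist tb distinct_card[of "take m xs"] by (simp add: m_def)
  have fP: "f \<in> permutations_of_set S"
  proof -
    have "set f = S" using dist(2) unfolding f_def by (metis append_take_drop_id set_append set_rev)
    moreover have "distinct f" using dist(1) unfolding f_def
      by (metis append_take_drop_id distinct_append distinct_rev set_rev)
    ultimately show ?thesis by (simp add: permutations_of_set_def)
  qed
  have above: "A \<in> prefix_members F f \<longleftrightarrow> A \<in> prefix_members F xs" if "b \<subseteq> A" for A
  proof (cases "A \<in> F")
    case True
    then have "finite A" using F dist(2) finite_subset by blast
    then have "m \<le> card A" using that card_mono unfolding m_def by blast
    then obtain r where r: "card A = m + r" using le_Suc_ex by blast
    have "set (take (card A) f) = set (take (card A) xs)"
      unfolding r take_add f_def using len by simp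
    then show ?thesis by (simp add: prefix_members_def)
  qed (simp add: prefix_members_def)
  have not_both: False if A: "A \<in> prefix_members F xs" "A \<subset> b"
    and B: "B \<in> prefix_members F f" "B \<subset> b" for A B
  proof -
    have "b - B \<in> prefix_members UNIV xs"
      using prefix_flip[OF dist(1) tb m_def, of B] B unfolding prefix_members_def f_def by auto
    then have "A \<subseteq> b - B \<or> b - B \<subseteq> A" using prefix_members_comparable A(1) by blast
    moreover have "A \<subseteq> B \<or> B \<subseteq> A" using chain A B unfolding prefix_members_def by blast
    moreover have "A \<noteq> {}" "B \<noteq> {}" using A B F unfolding prefix_members_def by auto
    ultimately show False using A B by blast
  qed
  have inv: "rev (take m f) @ drop m f = xs" using len unfolding f_def by simp
  show "rev (take (card b) xs) @ drop (card b) xs \<in> permutations_of_set S \<and>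
    rev (take (card b) (rev (take (card b) xs) @ drop (card b) xs)) @
      drop (card b) (rev (take (card b) xs) @ drop (card b) xs) = xs \<and>
    (\<forall>A. A = b \<or> b \<subset> A \<longrightarrow>
      (A \<in> prefix_members F (rev (take (card b) xs) @ drop (card b) xs) \<longleftrightarrow>
       A \<in> prefix_members F xs)) \<and>
    ((\<exists>A\<in>prefix_members F xs. A \<subset> b) \<longrightarrow>
     \<not> (\<exists>A\<in>prefix_members F (rev (take (card b) xs) @ drop (card b) xs). A \<subset> b))"
    unfolding m_def[symmetric] f_def[symmetric]
    using fP inv above not_both by blast
qed

lemma flippable_above:
  assumes F: "F \<subseteq> Pow S" "S \<notin> F" and b: "b \<in> F"
    and chain: "\<And>A B. A \<in> F \<Longrightarrow> B \<in> F \<Longrightarrow> b \<subset> A \<Longrightarrow> b \<subset> B \<Longrightarrow> A \<subseteq> B \<or> B \<subseteq> A"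
  shows "flippable (\<lambda>A B. B \<subset> A) (permutations_of_set S) (prefix_members F) b"
  unfolding flippable_def is_flip_def
proof (intro exI[of _ "\<lambda>xs. take (card b) xs @ rev (drop (card b) xs)"] ballI impI)
  fix xs assume xs: "xs \<in> permutations_of_set S" and hit: "b \<in> prefix_members F xs"
  define m where "m = card b"
  define f where "f = take m xs @ rev (drop m xs)"
  have dist: "distinct xs" "set xs = S" using xs by (auto simp: permutations_of_set_def)
  have tb: "set (take m xs) = b" using hit by (simp add: prefix_members_def m_def)
  have finb: "finite b" using tb by auto
  have len: "length (take m xs) = m"
    using dist tb distinct_card[of "take m xs"] by (simp add: m_def)
  have fP: "f \<in> permutations_of_set S"
  proof -
    have "set f = S" using dist(2) unfolding f_def by (metis append_take_drop_id set_append set_rev)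
    moreover have "distinct f" using dist(1) unfolding f_def
      by (metis append_take_drop_id distinct_append distinct_rev set_rev)
    ultimately show ?thesis by (simp add: permutations_of_set_def)
  qed
  have below: "A \<in> prefix_members F f \<longleftrightarrow> A \<in> prefix_members F xs" if "A \<subseteq> b" for A
  proof -
    have "card A \<le> m" using that finb card_mono unfolding m_def by blast
    then have "take (card A) f = take (card A) xs" unfolding f_def using len by simp
    then show ?thesis by (simp add: prefix_members_def)
  qed
  have not_both: False if A: "A \<in> prefix_members F xs" "b \<subset> A"
    and B: "B \<in> prefix_members F f" "b \<subset> B" for A B
  proof -
    have S: "A \<subset> S" "B \<subset> S" using A B F unfolding prefix_members_def by auto
    have "b \<union> (S - B) \<in> prefix_members UNIV xs"
      using suffix_flip[OF dist tb m_def, of B] B S unfolding prefix_members_def f_def by auto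
    then have "A \<subseteq> b \<union> (S - B) \<or> b \<union> (S - B) \<subseteq> A" using prefix_members_comparable A(1) by blast
    moreover have "A \<subseteq> B \<or> B \<subseteq> A" using chain A B unfolding prefix_members_def by blast
    ultimately show False using A B S by blast
  qed
  have inv: "take m f @ rev (drop m f) = xs" using len unfolding f_def by simp
  show "take (card b) xs @ rev (drop (card b) xs) \<in> permutations_of_set S \<and>
    take (card b) (take (card b) xs @ rev (drop (card b) xs)) @
      rev (drop (card b) (take (card b) xs @ rev (drop (card b) xs))) = xs \<and>
    (\<forall>A. A = b \<or> A \<subset> b \<longrightarrow>
      (A \<in> prefix_members F (take (card b) xs @ rev (drop (card b) xs)) \<longleftrightarrow>
       A \<in> prefix_members F xs)) \<and>
    ((\<exists>A\<in>prefix_members F xs. b \<subset> A) \<longrightarrow>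
     \<not> (\<exists>A\<in>prefix_members F (take (card b) xs @ rev (drop (card b) xs)). b \<subset> A))"
    unfolding m_def[symmetric] f_def[symmetric]
    using fP inv below not_both by blast
qed

lemma sum_prefix_members:
  assumes "finite S" "F \<subseteq> Pow S"
  shows "real (\<Sum>xs\<in>permutations_of_set S. card (prefix_members F xs))
    = fact (card S) * (\<Sum>A\<in>F. 1 / real (card S choose card A))"
proof -
  have finF: "finite F" using assms finite_subset by blast
  have "(\<Sum>xs\<in>permutations_of_set S. card (prefix_members F xs))
      = (\<Sum>A\<in>F. card {xs \<in> permutations_of_set S. set (take (card A) xs) = A})"
    unfolding prefix_members_def
    by (rule sum_multicount_gen) (use finF in auto)
  also have "\<dots> = (\<Sum>A\<in>F. fact (card A) * fact (card S - card A))"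
    by (rule sum.cong) (use assms in \<open>auto intro!: card_permutations_through\<close>)
  finally have "real (\<Sum>xs\<in>permutations_of_set S. card (prefix_members F xs))
      = (\<Sum>A\<in>F. fact (card A) * fact (card S - card A))" by simp
  also have "\<dots> = (\<Sum>A\<in>F. fact (card S) * (1 / real (card S choose card A)))"
  proof (rule sum.cong[OF refl])
    fix A assume "A \<in> F"
    then have "card A \<le> card S" using assms card_mono by blast
    then show "fact (card A) * fact (card S - card A)
        = fact (card S) * (1 / real (card S choose card A))"
      by (simp add: binomial_fact field_simps)
  qed
  finally show ?thesis by (simp add: sum_distrib_left)
qed

section \<open>The forbidden posets\<close>

text \<open>The transitive closure in closed form, so that both directions of an induced embedding can be
  checked case by case.\<close>

lemma Y_less_iff:
  assumes "k \<ge> 1"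
  shows "Y_less k = {(x_elem i, x_elem j) | i j. 1 \<le> i \<and> i < j \<and> j \<le> k} \<union>
    {(x_elem i, w) | i w. 1 \<le> i \<and> i \<le> k \<and> w \<in> {y_elem, z_elem}}" (is "_ = ?W")
proof
  have "(a, b) \<in> ?W" if "(a, b) \<in> Y_less k" for a b
    using that[unfolded Y_less_def]
  proof (induction rule: trancl_induct)
    case (base b)
    then show ?case using assms by (auto simp: Y_generators_def)
  next
    case (step b c)
    then show ?case by (auto simp: Y_generators_def)
  qed
  then show "Y_less k \<subseteq> ?W" by (rule subrelI)
  have up: "(x_elem i, x_elem j) \<in> Y_less k" if "1 \<le> i" "i < j" "j \<le> k" for i j
    using that(2,3)
  proof (induction j)
    case (Suc j)
    have s: "(x_elem j, x_elem (Suc j)) \<in> Y_generators k"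
      using Suc.prems that(1) by (auto simp: Y_generators_def)
    show ?case
    proof (cases "i = j")
      case True
      then show ?thesis using s by (auto simp: Y_less_def)
    next
      case False
      then show ?thesis using Suc s unfolding Y_less_def by (simp add: trancl_into_trancl)
    qed
  qed simp
  have "(x_elem i, w) \<in> Y_less k" if "1 \<le> i" "i \<le> k" "w \<in> {y_elem, z_elem}" for i w
  proof -
    have s: "(x_elem k, w) \<in> Y_generators k" using that by (auto simp: Y_generators_def)
    show ?thesis
    proof (cases "i = k")
      case True
      then show ?thesis using s by (auto simp: Y_less_def)
    next
      case False
      then show ?thesis using up[of i k] that s
        unfolding Y_less_def by (simp add: trancl_into_trancl)
    qed
  qed
  then show "?W \<subseteq> Y_less k" using up by blast
qed

text \<open>Stated for an abstract order: \<open>\<subset>\<close> yields a copy of \<open>Y\<^sub>k\<close> and its converse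
  yields a copy of the reversed poset.\<close>

lemma (in finite_strict_order) Y_embedding:
  assumes "ends_chain R F k A" "y \<in> F" "z \<in> F" "R A y" "R A z"
    and "y \<noteq> z" "\<not> R y z" "\<not> R z y"
  obtains \<phi> where "inj_on \<phi> (Y_carrier k)" "\<phi> ` Y_carrier k \<subseteq> F"
    "\<And>p q. p \<in> Y_carrier k \<Longrightarrow> q \<in> Y_carrier k \<Longrightarrow> (p, q) \<in> Y_less k \<longleftrightarrow> R (\<phi> p) (\<phi> q)"
proof -
  have k: "k \<ge> 1" using assms(1) by (rule ends_chain_pos)
  obtain c where c: "\<forall>i\<in>{1..k}. c i \<in> F" "\<forall>i. 1 \<le> i \<and> i < k \<longrightarrow> R (c i) (c (Suc i))" "c k = A"
    using ends_chain_enumeration[OF assms(1)] by blast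
  have up: "R (c i) (c j)" if "1 \<le> i" "i < j" "j \<le> k" for i j
    using that(2,3)
  proof (induction j)
    case (Suc j)
    have step: "R (c j) (c (Suc j))" using c(2) Suc that(1) by simp
    show ?case
    proof (cases "i = j")
      case False
      then have "R (c i) (c j)" using Suc by simp
      then show ?thesis using step by (rule trans)
    qed (use step in simp)
  qed simp
  have asym: "\<not> R q p" if "R p q" for p q using that irrefl trans by blast
  have top: "R (c i) y" "R (c i) z" if "1 \<le> i" "i \<le> k" for i
  proof -
    have "c i = A \<or> R (c i) A" using up[of i k] that c(3) by fastforce
    then show "R (c i) y" "R (c i) z" using assms(4,5) trans by blast+
  qed
  have iff: "R (c i) (c j) \<longleftrightarrow> i < j" if "1 \<le> i" "i \<le> k" "1 \<le> j" "j \<le> k" for i j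
    using that up[of i j] up[of j i] asym irrefl by (cases i j rule: linorder_cases) auto
  define \<phi> where "\<phi> p = (case p of x_elem i \<Rightarrow> c i | y_elem \<Rightarrow> y | z_elem \<Rightarrow> z)" for p
  have rel: "(p, q) \<in> Y_less k \<longleftrightarrow> R (\<phi> p) (\<phi> q)" if "p \<in> Y_carrier k" "q \<in> Y_carrier k" for p q
    using that assms(7,8) irrefl top iff asym[OF top(1)] asym[OF top(2)]
    unfolding Y_less_iff[OF k] Y_carrier_def \<phi>_def by auto
  show thesis
  proof
    show "\<phi> ` Y_carrier k \<subseteq> F"
      using c(1) assms(2,3) unfolding Y_carrier_def \<phi>_def by auto
    show "inj_on \<phi> (Y_carrier k)"
    proof (rule inj_onI)
      fix p q assume pq: "p \<in> Y_carrier k" "q \<in> Y_carrier k" "\<phi> p = \<phi> q"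
      have "\<not> R (\<phi> p) (\<phi> q)" "\<not> R (\<phi> q) (\<phi> p)" using pq(3) irrefl by auto
      then have "(p, q) \<notin> Y_less k" "(q, p) \<notin> Y_less k" using rel pq by auto
      then show "p = q"
        using pq assms(6) unfolding Y_less_iff[OF k] Y_carrier_def \<phi>_def
        by (auto simp: not_less dest!: leI)
    qed
  qed (rule rel)
qed

lemma finite_strict_order_subset: "finite F \<Longrightarrow> finite_strict_order (\<subset>) F"
  by unfold_locales auto

lemma finite_strict_order_supset: "finite F \<Longrightarrow> finite_strict_order (\<lambda>A B. B \<subset> A) F"
  by unfold_locales auto

text \<open>This and its counterpart \<open>comparable_below_low\<close> are the only places where the forbidden
  posets are used.\<close>

lemma comparable_above_high:
  assumes "finite F" "induced_Y_free k F" "k \<ge> 1" "k \<le> height (\<subset>) F b" "b \<in> F"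
    and AB: "A \<in> F" "B \<in> F" "b \<subset> A" "b \<subset> B"
  shows "A \<subseteq> B \<or> B \<subseteq> A"
proof (rule ccontr)
  interpret finite_strict_order "(\<subset>)" F by (rule finite_strict_order_subset[OF assms(1)])
  assume no: "\<not> (A \<subseteq> B \<or> B \<subseteq> A)"
  have "ends_chain (\<subset>) F k b"
    by (rule ends_chain_shorter[OF ends_chain_height]) (use assms in auto)
  then obtain \<phi> where phi: "inj_on \<phi> (Y_carrier k)" "\<phi> ` Y_carrier k \<subseteq> F"
    "\<And>p q. p \<in> Y_carrier k \<Longrightarrow> q \<in> Y_carrier k \<Longrightarrow> (p, q) \<in> Y_less k \<longleftrightarrow> \<phi> p \<subset> \<phi> q"
    by (rule Y_embedding[of k b A B]) (use AB no in auto)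
  have "\<not> induced_subposet (Y_carrier k) (Y_less k) F (containment F)"
    using assms(2) unfolding induced_Y_free_def induced_free_def .
  moreover have "induced_subposet (Y_carrier k) (Y_less k) F (containment F)"
    unfolding induced_subposet_def containment_def
    by (rule exI[of _ \<phi>]) (use phi in \<open>auto simp: image_subset_iff\<close>)
  ultimately show False by blast
qed

lemma comparable_below_low:
  assumes "finite F" "induced_Y'_free k F" "k \<ge> 1" "k \<le> height (\<lambda>A B. B \<subset> A) F b" "b \<in> F"
    and AB: "A \<in> F" "B \<in> F" "A \<subset> b" "B \<subset> b"
  shows "A \<subseteq> B \<or> B \<subseteq> A"
proof (rule ccontr)
  interpret finite_strict_order "\<lambda>A B. B \<subset> A" F by (rule finite_strict_order_supset[OF assms(1)])
  assume no: "\<not> (A \<subseteq> B \<or> B \<subseteq> A)"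
  have "ends_chain (\<lambda>A B. B \<subset> A) F k b"
    by (rule ends_chain_shorter[OF ends_chain_height]) (use assms in auto)
  then obtain \<phi> where phi: "inj_on \<phi> (Y_carrier k)" "\<phi> ` Y_carrier k \<subseteq> F"
    "\<And>p q. p \<in> Y_carrier k \<Longrightarrow> q \<in> Y_carrier k \<Longrightarrow> (p, q) \<in> Y_less k \<longleftrightarrow> \<phi> q \<subset> \<phi> p"
    by (rule Y_embedding[of k b A B]) (use AB no in auto)
  have "\<not> induced_subposet (Y_carrier k) ((Y_less k)\<inverse>) F (containment F)"
    using assms(2) unfolding induced_Y'_free_def induced_free_def .
  moreover have "induced_subposet (Y_carrier k) ((Y_less k)\<inverse>) F (containment F)"
    unfolding induced_subposet_def containment_def
    by (rule exI[of _ \<phi>]) (use phi in \<open>auto simp: image_subset_iff\<close>)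
  ultimately show False by blast
qed

section \<open>The inequality\<close>

theorem theorem4:
  fixes k n :: nat and \<A> :: "nat set set"
  assumes "k \<ge> 2" and "n \<ge> k + 1"
    and "\<A> \<subseteq> Pow {1..n}"
    and "induced_Y_free k \<A>" and "induced_Y'_free k \<A>"
    and "{} \<notin> \<A>" and "{1..n} \<notin> \<A>"
  shows "(\<Sum>A\<in>\<A>. 1 / real (n choose card A)) \<le> real k"
proof -
  have fin: "finite \<A>" using assms(3) finite_subset by blast
  have k: "k \<ge> 1" using assms(1) by simp
  interpret flip_system "(\<subset>)" \<A> "permutations_of_set {1..n}" "prefix_members \<A>" k
  proof
    fix xs A B assume "A \<in> prefix_members \<A> xs" "B \<in> prefix_members \<A> xs"
    then show "A = B \<or> A \<subset> B \<or> B \<subset> A" using prefix_members_comparable by blast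
  next
    fix b assume "b \<in> \<A>" "k \<le> height (\<lambda>A B. B \<subset> A) \<A> b"
    then show "flippable (\<subset>) (permutations_of_set {1..n}) (prefix_members \<A>) b"
      using assms flippable_below comparable_below_low[OF fin assms(5) k] by metis
  next
    fix b assume "b \<in> \<A>" "k \<le> height (\<subset>) \<A> b"
    then show "flippable (\<lambda>A B. B \<subset> A) (permutations_of_set {1..n}) (prefix_members \<A>) b"
      using assms flippable_above comparable_above_high[OF fin assms(4) k] by metis
  qed (use fin assms(1) in \<open>auto simp: prefix_members_def\<close>)
  have "real (\<Sum>xs\<in>permutations_of_set {1..n}. card (prefix_members \<A> xs))
      \<le> real (k * card (permutations_of_set {1..n}))"
    by (rule of_nat_mono) (rule sum_card_H)
  then have "fact n * (\<Sum>A\<in>\<A>. 1 / real (n choose card A)) \<le> fact n * real k"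
    unfolding sum_prefix_members[OF finite_atLeastAtMost assms(3)] by (simp add: mult.commute)
  then show ?thesis by (rule mult_left_le_imp_le) simp
qed

end
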